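(* Let $n\ge1$, let $\mathcal{U}_s\subseteq\mathbb{Z}_{2^n}$ be the index set of shortened encoder input bits of the polar code of length $2^n$, and let $\mathcal{X}_s\subseteq\mathbb{Z}_{2^n}$ be the index set of the encoder output bits fixed to zero by this shortening. For any $j\in\mathbb{Z}_{2^n}$, if $j\in\mathcal{X}_s$, then $\mathcal{G}_j\subseteq\mathcal{X}_s$. In other words, $\mathcal{X}_s$ complies with binary domination.
   Context: Let $\mathbb{Z}_{2^n}=\{0,1,\ldots,2^n-1\}$ and write $i=\sum_{t=0}^{n-1}i_t2^t$ with $i_t\in\{0,1\}$. Binary domination: $i\preceq j$ (equivalently $j\succeq i$) iff $i_t\le j_t$ for all $t$. $\mathcal{D}_j=\{k\in\mathbb{Z}_{2^n}:k\preceq j\}$ and $\mathcal{G}_j=\{k\in\mathbb{Z}_{2^n}:k\succeq j\}$. A set $\mathcal{A}\subseteq\mathbb{Z}_{2^n}$ complies with binary domination if either $\mathcal{D}_j\subseteq\mathcal{A}$ for all $j\in\mathcal{A}$, or $\mathcal{G}_j\subseteq\mathcal{A}$ for all $j\in\mathcal{A}$. The polar code of length $2^n$ encodes $\mathbf{u}\in\mathbb{F}_2^{2^n}$ to $\mathbf{x}=\mathbf{u}\left[\begin{smallmatrix}1&0\\1&1\end{smallmatrix}\right]^{\otimes n}$ (rows and columns indexed by $\mathbb{Z}_{2^n}$ in the natural order). Shortening the input bits with indices in $\mathcal{U}_s$ means setting $u_i=0$ for all $i\in\mathcal{U}_s$. The output bit $x_j$ is fixed (to zero) if $x_j=0$ for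 every $\mathbf{u}\in\mathbb{F}_2^{2^n}$ with $u_i=0$ for all $i\in\mathcal{U}_s$; $\mathcal{X}_s$ is the set of all $j$ such that $x_j$ is fixed. *)

theory Defs
  imports Jordan_Normal_Form.Matrix "HOL-Library.Z2"
begin

text \<open>
  In types, \<open>bit\<close> is the two-element field of \<open>HOL-Library.Z2\<close>; in terms, \<open>bit i t\<close> is the
  library predicate saying that the binary digit of weight \<open>2 ^ t\<close> in \<open>i\<close> is one.
\<close>

abbreviation indices :: "nat \<Rightarrow> nat set" where
  "indices n \<equiv> {..<2 ^ n}"

text \<open>For digits, \<open>i\<^sub>t \<le> j\<^sub>t\<close> is the implication below.\<close>

definition dominated :: "nat \<Rightarrow> nat \<Rightarrow> nat \<Rightarrow> bool" where
  "dominated n i j \<longleftrightarrow> (\<forall>t<n. bit i t \<longrightarrow> bit j t)"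

definition down_set :: "nat \<Rightarrow> nat \<Rightarrow> nat set" where
  "down_set n j = {k \<in> indices n. dominated n k j}"

definition up_set :: "nat \<Rightarrow> nat \<Rightarrow> nat set" where
  "up_set n j = {k \<in> indices n. dominated n j k}"

definition complies_with_domination :: "nat \<Rightarrow> nat set \<Rightarrow> bool" where
  "complies_with_domination n A \<longleftrightarrow>
     A \<subseteq> indices n \<and> ((\<forall>j\<in>A. down_set n j \<subseteq> A) \<or> (\<forall>j\<in>A. up_set n j \<subseteq> A))"

definition kronecker_prod :: "'a::times mat \<Rightarrow> 'a mat \<Rightarrow> 'a mat" where
  "kronecker_prod A B =
     mat (dim_row A * dim_row B) (dim_col A * dim_col B)
       (\<lambda>(i, j). A $$ (i div dim_row B, j div dim_col B) * B $$ (i mod dim_row B, j mod dim_col B))"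

primrec kronecker_power :: "'a::semiring_1 mat \<Rightarrow> nat \<Rightarrow> 'a mat" where
  "kronecker_power A 0 = 1\<^sub>m 1"
| "kronecker_power A (Suc n) = kronecker_prod A (kronecker_power A n)"

definition polar_kernel :: "bit mat" where
  "polar_kernel = mat_of_rows_list 2 [[1, 0], [1, 1]]"

text \<open>The input acts from the left, as a row vector.\<close>

definition polar_encode :: "nat \<Rightarrow> bit vec \<Rightarrow> bit vec" where
  "polar_encode n u = row (mat_of_row u * kronecker_power polar_kernel n) 0"

definition shortened_inputs :: "nat \<Rightarrow> nat set \<Rightarrow> bit vec set" where
  "shortened_inputs n Us = {u \<in> carrier_vec (2 ^ n). \<forall>i\<in>Us. u $ i = 0}"

definition fixed_outputs :: "nat \<Rightarrow> nat set \<Rightarrow> nat set" where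
  "fixed_outputs n Us =
     {j \<in> indices n. \<forall>u\<in>shortened_inputs n Us. polar_encode n u $ j = 0}"

end

theory Submission
  imports Defs
begin

text \<open>
  The entry of the polar transform at \<open>(i, j)\<close> is one iff \<open>i\<close> dominates \<open>j\<close>, so \<open>x\<^sub>j\<close> is the sum of
  the \<open>u\<^sub>i\<close> over the indices \<open>i\<close> above \<open>j\<close>. Testing with unit vectors, \<open>x\<^sub>j\<close> is fixed iff all of
  these inputs are shortened, and this property passes to every \<open>k\<close> above \<open>j\<close> because
  domination is transitive.
\<close>

lemma dominated_trans: "dominated n i j \<Longrightarrow> dominated n j k \<Longrightarrow> dominated n i k"
  by (simp add: dominated_def)

lemma up_set_antimono: "dominated n j k \<Longrightarrow> up_set n k \<subseteq> up_set n j"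
  by (auto simp: up_set_def intro: dominated_trans)

text \<open>The leading digit is split off because \<open>kronecker_power\<close> puts each new
  factor on the left: the quotient of an index by \<open>2 ^ n\<close> addresses that factor, the
  remainder addresses the previous power.\<close>

lemma dominated_Suc_iff:
  "dominated (Suc n) i j \<longleftrightarrow>
    (bit i n \<longrightarrow> bit j n) \<and> dominated n (i mod 2 ^ n) (j mod 2 ^ n)"
  by (auto simp: dominated_def less_Suc_eq bit_take_bit_iff simp flip: take_bit_eq_mod)

lemma div_power_2_eq_of_bool_bit:
  fixes i :: nat
  assumes "i < 2 ^ Suc n"
  shows "i div 2 ^ n = of_bool (bit i n)"
proof -
  have "i div 2 ^ n < 2"
    using assms by (simp add: less_mult_imp_div_less)
  then have "i div 2 ^ n = 0 \<or> i div 2 ^ n = 1"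
    by linarith
  then show ?thesis
    by (auto simp: bit_iff_odd)
qed

lemma dim_polar_kernel [simp]: "dim_row polar_kernel = 2" "dim_col polar_kernel = 2"
  by (simp_all add: polar_kernel_def mat_of_rows_list_def)

text \<open>Writing indices as \<open>of_bool\<close> of digits turns the kernel into one-digit
  domination, with the column below the row.\<close>

lemma polar_kernel_entry: "polar_kernel $$ (of_bool a, of_bool b) = of_bool (b \<longrightarrow> a)"
  by (cases a; cases b) (simp_all add: polar_kernel_def mat_of_rows_list_def)

lemma dim_polar_transform [simp]:
  "dim_row (kronecker_power polar_kernel n) = 2 ^ n"
  "dim_col (kronecker_power polar_kernel n) = 2 ^ n"
  by (induction n) (simp_all add: kronecker_prod_def)

lemma polar_transform_entry:
  assumes "i < 2 ^ n" "j < 2 ^ n"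
  shows "kronecker_power polar_kernel n $$ (i, j) = of_bool (dominated n j i)"
  using assms
proof (induction n arbitrary: i j)
  case 0
  then show ?case
    by (simp add: dominated_def)
next
  case (Suc n)
  have "kronecker_power polar_kernel (Suc n) $$ (i, j) =
      polar_kernel $$ (i div 2 ^ n, j div 2 ^ n) *
      kronecker_power polar_kernel n $$ (i mod 2 ^ n, j mod 2 ^ n)"
    using Suc.prems by (simp add: kronecker_prod_def)
  \<comment> \<open>A product of two indicators is the indicator of the conjunction, so the
    conditions on the leading digit and on the lower digits combine into domination on
    \<open>Suc n\<close> digits.\<close>
  also have "\<dots> = of_bool (bit j n \<longrightarrow> bit i n) * of_bool (dominated n (j mod 2 ^ n) (i mod 2 ^ n))"
    using Suc by (simp only: div_power_2_eq_of_bool_bit polar_kernel_entry) simp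
  finally show ?case
    by (simp only: dominated_Suc_iff of_bool_conj)
qed

lemma polar_encode_nth:
  assumes "u \<in> carrier_vec (2 ^ n)" "j < 2 ^ n"
  shows "polar_encode n u $ j = (\<Sum>i\<in>up_set n j. u $ i)"
proof -
  have "polar_encode n u $ j = (\<Sum>i<2 ^ n. u $ i * of_bool (dominated n j i))"
    using assms
    by (simp add: polar_encode_def scalar_prod_def polar_transform_entry lessThan_atLeast0)
  also have "\<dots> = (\<Sum>i\<in>up_set n j. u $ i)"
    unfolding up_set_def by (rule sum.mono_neutral_cong_right) auto
  finally show ?thesis .
qed

lemma fixed_outputs_iff:
  assumes "Us \<subseteq> indices n"
  shows "j \<in> fixed_outputs n Us \<longleftrightarrow> j < 2 ^ n \<and> up_set n j \<subseteq> Us"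
proof (intro iffI conjI subsetI)
  assume fixed: "j \<in> fixed_outputs n Us"
  then show j: "j < 2 ^ n"
    by (simp add: fixed_outputs_def)
  fix i
  assume i: "i \<in> up_set n j"
  then have "i < 2 ^ n"
    by (simp add: up_set_def)
  show "i \<in> Us"
  proof (rule ccontr)
    assume "i \<notin> Us"
    \<comment> \<open>This unit vector is an admissible input because \<open>i\<close> is not
      shortened, yet it makes output \<open>j\<close> equal to one.\<close>
    define u :: "bit vec" where "u = vec (2 ^ n) (\<lambda>k. of_bool (k = i))"
    have "(\<Sum>k\<in>up_set n j. u $ k) = (\<Sum>k\<in>up_set n j. of_bool (k = i))"
      by (rule sum.cong) (auto simp: u_def up_set_def)
    also have "\<dots> = 1"
      using i by (simp add: up_set_def)
    finally have "polar_encode n u $ j = 1"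
      using j by (simp add: polar_encode_nth u_def)
    moreover have "polar_encode n u $ j = 0"
      \<comment> \<open>The bound on \<open>Us\<close> matters here: the entries of \<open>u\<close>
        are specified only at indices below \<open>2 ^ n\<close>.\<close>
      using fixed assms \<open>i \<notin> Us\<close>
      by (force simp: fixed_outputs_def shortened_inputs_def u_def)
    ultimately show False
      by simp
  qed
next
  assume "j < 2 ^ n \<and> up_set n j \<subseteq> Us"
  then show "j \<in> fixed_outputs n Us"
    by (auto simp: fixed_outputs_def shortened_inputs_def polar_encode_nth intro!: sum.neutral)
qed

theorem theorem17:
  fixes n :: nat and Us :: "nat set"
  assumes "n \<ge> 1"
    and "Us \<subseteq> indices n"
  shows "(\<forall>j\<in>indices n. j \<in> fixed_outputs n Us \<longrightarrow> up_set n j \<subseteq> fixed_outputs n Us)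
    \<and> complies_with_domination n (fixed_outputs n Us)"
proof -
  \<comment> \<open>For \<open>k\<close> above \<open>j\<close>, the chain
    \<open>up_set n k \<subseteq> up_set n j \<subseteq> Us\<close> shows that \<open>k\<close> is
    fixed too.\<close>
  have "up_set n j \<subseteq> fixed_outputs n Us" if "j \<in> fixed_outputs n Us" for j
    using that up_set_antimono unfolding fixed_outputs_iff[OF assms(2)] subset_iff
    by (fastforce simp: up_set_def)
  then show ?thesis
    by (auto simp: complies_with_domination_def fixed_outputs_iff[OF assms(2)])
qed

end
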